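(* Let $A=[a_{ij}]\in\mathbb{R}^{n\times n}$ be a nonnegative matrix with zero diagonal and let $\alpha_{ij}\in(0,1)$ be given for all $i$ and all $j\in N_i=\{j\ne i: a_{ij}>0\}$. Consider the system $\dot x_i(t)=u_i(t)$, $i=1,\dots,n$, with $x_i(t)\in\mathbb{R}$ and $$u_i=\sum_{j\in N_i}a_{ij}\operatorname{sig}(x_j-x_i)^{\alpha_{ij}}$$ (with $u_i=0$ if $N_i=\emptyset$). If $\mathcal{G}(A)$ is strongly connected and detail-balanced, and $\alpha_{ij}=\alpha_{ji}$ for all $i$ and all $j\in N_i$, then the system solves a finite-time consensus problem.
   Context: For $r\in\mathbb{R}$ and $\alpha>0$, $\operatorname{sig}(r)^\alpha:=\operatorname{sign}(r)|r|^\alpha$, with $\operatorname{sign}(0)=0$. The weighted directed graph $\mathcal{G}(A)$ has vertices $v_1,\dots,v_n$ and an edge $(v_i,v_j)$ (from $v_i$ to $v_j$) if and only if $a_{ji}>0$; it is strongly connected if for every pair of distinct vertices there is a directed path from the first to the second. $\mathcal{G}(A)$ is detail-balanced (satisfies the detail balance condition in weights) if there exist scalars $\omega_i>0$, $i=1,\dots,n$, such that $\omega_i a_{ij}=\omega_j a_{ji}$ for all $i,j$. Solutions are differentiable functions on $[0,\infty)$. The system solves a finite-time consensus problem if for every initial state $x(0)\in\mathbb{R}^n$ and every solution $x(t)$ on $[0,\infty)$ with that initial state, $|x_j(t)-x_k(t)|\to0$ as $t\to\infty$ for all $j,k$, and there exist a time $t^*$ and a real number $\kappa$ such that $x_j(t)=\kappa$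 for all $t\ge t^*$ and all $j$. *)

theory Defs
  imports "Graph_Theory.Digraph_Component" "HOL-Analysis.Analysis"
begin

definition sig :: "real \<Rightarrow> real \<Rightarrow> real" where
  "sig r \<alpha> = sgn r * \<bar>r\<bar> powr \<alpha>"

text \<open>The entry \<open>a\<^sub>i\<^sub>j\<close> is \<open>A $ i $ j\<close> and is the weight of the arc from \<open>j\<close> to \<open>i\<close>.\<close>

definition matrix_digraph :: "real ^ 'n ^ 'n \<Rightarrow> ('n, 'n \<times> 'n) pre_digraph" where
  "matrix_digraph A = \<lparr>verts = UNIV, arcs = {(i, j). A $ j $ i > 0}, tail = fst, head = snd\<rparr>"

definition detail_balanced :: "real ^ 'n ^ 'n \<Rightarrow> bool" where
  "detail_balanced A \<longleftrightarrow>
    (\<exists>\<omega> :: 'n \<Rightarrow> real. (\<forall>i. \<omega> i > 0) \<and> (\<forall>i j. \<omega> i * A $ i $ j = \<omega> j * A $ j $ i))"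

definition neighbours :: "real ^ 'n ^ 'n \<Rightarrow> 'n \<Rightarrow> 'n set" where
  "neighbours A i = {j. j \<noteq> i \<and> A $ i $ j > 0}"

definition consensus_protocol ::
    "real ^ 'n ^ 'n \<Rightarrow> ('n \<Rightarrow> 'n \<Rightarrow> real) \<Rightarrow> real ^ 'n \<Rightarrow> real ^ 'n::finite" where
  "consensus_protocol A \<alpha> x =
    (\<chi> i. \<Sum>j\<in>neighbours A i. A $ i $ j * sig (x $ j - x $ i) (\<alpha> i j))"

text \<open>Only the values on \<open>[0, \<infinity>)\<close> matter; at \<open>0\<close> the derivative is the right-hand one.\<close>

definition is_solution :: "(real ^ 'n \<Rightarrow> real ^ 'n) \<Rightarrow> (real \<Rightarrow> real ^ 'n::finite) \<Rightarrow> bool" where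
  "is_solution f x \<longleftrightarrow> (\<forall>t\<ge>0. (x has_vector_derivative f (x t)) (at t within {0..}))"

definition solves_finite_time_consensus :: "(real ^ 'n \<Rightarrow> real ^ 'n::finite) \<Rightarrow> bool" where
  "solves_finite_time_consensus f \<longleftrightarrow>
    (\<forall>x\<^sub>0 x. is_solution f x \<and> x 0 = x\<^sub>0 \<longrightarrow>
      (\<forall>j k. ((\<lambda>t. \<bar>x t $ j - x t $ k\<bar>) \<longlongrightarrow> 0) at_top) \<and>
      (\<exists>T\<ge>0. \<exists>\<kappa>. \<forall>t\<ge>T. \<forall>j. x t $ j = \<kappa>))"

end

theory Submission
  imports Defs
begin

text \<open>
  Detail balance makes the interaction weights \<open>w\<^sub>i\<^sub>j = \<omega>\<^sub>i a\<^sub>i\<^sub>j\<close> symmetric. Since each flow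
  \<open>w\<^sub>i\<^sub>j sig (x\<^sub>j - x\<^sub>i)\<^sup>\<alpha>\<close> is then antisymmetric in \<open>i, j\<close>, the weighted mean
  \<open>\<kappa> = \<Sum> \<omega>\<^sub>i x\<^sub>i / \<Sum> \<omega>\<^sub>i\<close> is conserved, and the energy \<open>E = \<Sum> \<omega>\<^sub>i (x\<^sub>i - \<kappa>)\<^sup>2\<close> is a Lyapunov
  function: summation by parts gives
  \<open>E' = - \<Sum> w\<^sub>i\<^sub>j \<bar>x\<^sub>j - x\<^sub>i\<bar> powr (1 + \<alpha>\<^sub>i\<^sub>j)\<close> (lemma \<open>symmetric_flow_dissipation\<close>).

  The exponents \<open>1 + \<alpha>\<^sub>i\<^sub>j\<close> lie strictly below 2, which is what turns asymptotic decay into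
  extinction. By strong connectivity all differences are controlled by differences along arcs, so
  some arc carries a difference of order at least \<open>sqrt E\<close>. As \<open>E\<close> stays below its initial
  value, that one arc dissipates at least \<open>c * E powr \<beta>\<close>, with \<open>\<beta> = (1 + max \<alpha>) / 2 < 1\<close>
  (lemma \<open>dissipation_ge_energy_powr\<close>). The inequality \<open>E' \<le> - c * E powr \<beta>\<close> makes
  \<open>E powr (1 - \<beta>)\<close> decrease at least linearly, so \<open>E\<close> vanishes after a finite time
  (lemma \<open>finite_time_extinction\<close>), and then every agent sits at \<open>\<kappa>\<close>.
\<close>

section \<open>Extinction in finite time\<close>

lemma decrease_of_derivative_le:
  fixes f :: "real \<Rightarrow> real"
  assumes "a \<le> b"
    and "\<And>t. a \<le> t \<Longrightarrow> t \<le> b \<Longrightarrow> (f has_real_derivative f' t) (at t within {a..b})"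
    and "\<And>t. a \<le> t \<Longrightarrow> t \<le> b \<Longrightarrow> f' t \<le> k"
  shows "f b \<le> f a + k * (b - a)"
proof (cases "a = b")
  case False
  then have "a < b" using assms(1) by simp
  then obtain t where t: "t \<in> {a<..<b}" "f b - f a = f' t * (b - a)"
    using mvt_simple[of a b f "\<lambda>t h. f' t * h"] assms(2)
    by (auto simp: has_field_derivative_def)
  have "f' t * (b - a) \<le> k * (b - a)"
    using t(1) assms(3)[of t] \<open>a < b\<close> by (intro mult_right_mono) auto
  with t(2) show ?thesis by simp
qed simp

text \<open>
  As long as \<open>V\<close> is positive, the chain rule bounds the slope of \<open>V powr (1 - \<beta>)\<close> by
  \<open>- (1 - \<beta>) * c\<close>, so positivity cannot last longer than
  \<open>V 0 powr (1 - \<beta>) / ((1 - \<beta>) * c)\<close>.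
\<close>

lemma finite_time_extinction:
  fixes V :: "real \<Rightarrow> real"
  assumes deriv: "\<And>t. t \<ge> 0 \<Longrightarrow> (V has_real_derivative V' t) (at t within {0..})"
    and nonneg: "\<And>t. t \<ge> 0 \<Longrightarrow> V t \<ge> 0"
    and decay: "\<And>t. t \<ge> 0 \<Longrightarrow> V' t \<le> - c * V t powr \<beta>"
    and "c > 0" "\<beta> < 1"
  shows "\<exists>T\<ge>0. \<forall>t\<ge>T. V t = 0"
proof -
  have antimono: "V t \<le> V s" if "0 \<le> s" "s \<le> t" for s t
  proof -
    have "V t \<le> V s + 0 * (t - s)"
    proof (rule decrease_of_derivative_le[where f' = V'])
      fix r assume r: "s \<le> r" "r \<le> t"
      then show "(V has_real_derivative V' r) (at r within {s..t})"
        using deriv[of r] that by (auto intro: DERIV_subset)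
      have "c * V r powr \<beta> \<ge> 0" using \<open>c > 0\<close> by simp
      then show "V' r \<le> 0" using decay[of r] r that by simp
    qed (use that in simp)
    then show ?thesis by simp
  qed
  define k where "k = (1 - \<beta>) * c"
  have k: "k > 0" using assms by (simp add: k_def)
  define T where "T = V 0 powr (1 - \<beta>) / k"
  have T: "T \<ge> 0" using k by (simp add: T_def)
  have "V T = 0"
  proof (rule ccontr)
    assume "V T \<noteq> 0"
    then have pos: "V t > 0" if "0 \<le> t" "t \<le> T" for t
      using antimono[OF that] nonneg[OF T] by simp
    have "V T powr (1 - \<beta>) \<le> V 0 powr (1 - \<beta>) + (- k) * (T - 0)"
    proof (rule decrease_of_derivative_le[OF T])
      fix t assume t: "0 \<le> t" "t \<le> T"
      have "((\<lambda>x. V x powr (1 - \<beta>)) has_real_derivative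
              (1 - \<beta>) * V t powr (1 - \<beta> - 1) * V' t) (at t within {0..})"
        using DERIV_chain2[OF has_real_derivative_powr[OF pos[OF t]] deriv[OF t(1)]] .
      then show "((\<lambda>x. V x powr (1 - \<beta>)) has_real_derivative
              (1 - \<beta>) * V t powr (- \<beta>) * V' t) (at t within {0..T})"
        by (auto intro: DERIV_subset)
      have "(1 - \<beta>) * V t powr (- \<beta>) * V' t
          \<le> (1 - \<beta>) * V t powr (- \<beta>) * (- c * V t powr \<beta>)"
        using decay[OF t(1)] \<open>\<beta> < 1\<close> by (intro mult_left_mono) auto
      also have "\<dots> = - k"
        using pos[OF t] by (simp add: k_def powr_minus field_simps)
      finally show "(1 - \<beta>) * V t powr (- \<beta>) * V' t \<le> - k" .
    qed
    moreover have "k * T = V 0 powr (1 - \<beta>)" using k by (simp add: T_def)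
    ultimately show False using pos[of T] T by simp
  qed
  then have "V t = 0" if "t \<ge> T" for t
    using antimono[OF T that] nonneg[of t] T that by simp
  with T show ?thesis by blast
qed

section \<open>Symmetric flows\<close>

lemma abs_sig_mult: "r * sig r a = \<bar>r\<bar> powr (1 + a)"
  by (cases r "0 :: real" rule: linorder_cases) (auto simp: sig_def powr_add)

lemma sig_minus: "sig (- r) a = - sig r a"
  by (simp add: sig_def)

lemma sum_antisymmetric_eq_0:
  fixes g :: "'a \<Rightarrow> 'a \<Rightarrow> real"
  assumes "\<And>i j. g j i = - g i j"
  shows "(\<Sum>i\<in>S. \<Sum>j\<in>S. g i j) = 0"
proof -
  have "(\<Sum>i\<in>S. \<Sum>j\<in>S. g i j) = (\<Sum>i\<in>S. \<Sum>j\<in>S. g j i)" by (rule sum.swap)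
  also have "\<dots> = - (\<Sum>i\<in>S. \<Sum>j\<in>S. g i j)" by (subst assms) (simp add: sum_negf)
  finally show ?thesis by simp
qed

lemma sum_by_parts_antisymmetric:
  fixes g :: "'a \<Rightarrow> 'a \<Rightarrow> real"
  assumes "\<And>i j. g j i = - g i j"
  shows "2 * (\<Sum>i\<in>S. p i * (\<Sum>j\<in>S. g i j)) = - (\<Sum>i\<in>S. \<Sum>j\<in>S. (p j - p i) * g i j)"
proof -
  have "(\<Sum>i\<in>S. \<Sum>j\<in>S. p j * g i j) = (\<Sum>i\<in>S. \<Sum>j\<in>S. p i * g j i)" by (rule sum.swap)
  also have "\<dots> = - (\<Sum>i\<in>S. \<Sum>j\<in>S. p i * g i j)" by (subst assms) (simp add: sum_negf)
  finally show ?thesis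
    by (simp add: left_diff_distrib sum_subtractf flip: sum_distrib_left)
qed

lemma symmetric_flow_antisymmetric:
  fixes w \<alpha> :: "'n \<Rightarrow> 'n \<Rightarrow> real"
  assumes "\<And>i j. w i j = w j i" "\<And>i j. w i j \<noteq> 0 \<Longrightarrow> \<alpha> i j = \<alpha> j i"
  shows "w j i * sig (p i - p j) (\<alpha> j i) = - (w i j * sig (p j - p i) (\<alpha> i j))"
  using assms(1)[of i j] assms(2)[of i j] sig_minus[of "p j - p i" "\<alpha> i j"]
  by (cases "w i j = 0") auto

text \<open>
  Pairing the flows along \<open>(i, j)\<close> and \<open>(j, i)\<close> turns the rate of change of the energy into a
  sum of terms of one sign.
\<close>

lemma symmetric_flow_dissipation:
  fixes w \<alpha> :: "'n::finite \<Rightarrow> 'n \<Rightarrow> real"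
  assumes "\<And>i j. w i j = w j i" "\<And>i j. w i j \<noteq> 0 \<Longrightarrow> \<alpha> i j = \<alpha> j i"
  shows "2 * (\<Sum>i\<in>UNIV. p i * (\<Sum>j\<in>UNIV. w i j * sig (p j - p i) (\<alpha> i j)))
       = - (\<Sum>i\<in>UNIV. \<Sum>j\<in>UNIV. w i j * \<bar>p j - p i\<bar> powr (1 + \<alpha> i j))"
  using sum_by_parts_antisymmetric[where S = UNIV and p = p
      and g = "\<lambda>i j. w i j * sig (p j - p i) (\<alpha> i j)",
      OF symmetric_flow_antisymmetric[where w = w and \<alpha> = \<alpha> and p = p, OF assms]]
  by (simp add: abs_sig_mult[symmetric] mult.left_commute)

section \<open>Dissipation controls the energy\<close>

text \<open>
  \<open>L\<close> can be the length of a walk. What matters is that it depends on the graph alone, so that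
  the energy estimate below has one constant for all states of a solution.
\<close>

lemma difference_le_along_walk:
  assumes "(i, j) \<in> r\<^sup>*"
  shows "\<exists>L\<ge>0. \<forall>(p :: 'a \<Rightarrow> real) d. (\<forall>(u, v)\<in>r. \<bar>p v - p u\<bar> \<le> d) \<longrightarrow> \<bar>p j - p i\<bar> \<le> L * d"
  using assms
proof (induction rule: rtrancl_induct)
  case base
  show ?case by (rule exI[of _ 0]) simp
next
  case (step j k)
  then obtain L :: real where L: "L \<ge> 0"
    "\<And>p :: 'a \<Rightarrow> real. \<And>d. (\<forall>(u, v)\<in>r. \<bar>p v - p u\<bar> \<le> d) \<Longrightarrow> \<bar>p j - p i\<bar> \<le> L * d" by blast
  have "\<bar>p k - p i\<bar> \<le> (L + 1) * d" if "\<forall>(u, v)\<in>r. \<bar>p v - p u\<bar> \<le> d" for p :: "'a \<Rightarrow> real" and d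
  proof -
    have "\<bar>p k - p j\<bar> \<le> d" using that step.hyps(2) by auto
    with L(2)[OF that] show ?thesis by (simp add: algebra_simps)
  qed
  with L(1) show ?case by (intro exI[of _ "L + 1"]) auto
qed

lemma difference_le_of_connected:
  fixes r :: "('n::finite \<times> 'n) set"
  assumes "\<And>i j. (i, j) \<in> r\<^sup>*"
  shows "\<exists>L\<ge>0. \<forall>(p :: 'n \<Rightarrow> real) d. d \<ge> 0 \<longrightarrow> (\<forall>(u, v)\<in>r. \<bar>p v - p u\<bar> \<le> d) \<longrightarrow>
           (\<forall>i j. \<bar>p j - p i\<bar> \<le> L * d)"
proof -
  from difference_le_along_walk[OF assms] obtain L :: "'n \<Rightarrow> 'n \<Rightarrow> real" where
    L: "\<And>i j. L i j \<ge> 0" "\<And>i j p d. (\<forall>(u, v)\<in>r. \<bar>p v - p u\<bar> \<le> d) \<Longrightarrow> \<bar>p j - p i\<bar> \<le> L i j * d"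
    by metis
  define M where "M = (\<Sum>i\<in>UNIV. \<Sum>j\<in>UNIV. L i j)"
  have le: "L i j \<le> M" for i j
  proof -
    have "L i j \<le> (\<Sum>j\<in>UNIV. L i j)" by (rule member_le_sum) (auto simp: L)
    also have "\<dots> \<le> M" unfolding M_def
      by (rule member_le_sum[where f = "\<lambda>i. \<Sum>j\<in>UNIV. L i j"]) (auto simp: L intro: sum_nonneg)
    finally show ?thesis .
  qed
  have "M \<ge> 0" using le L(1) order_trans by blast
  moreover have "\<bar>p j - p i\<bar> \<le> M * d" if "d \<ge> 0" "\<forall>(u, v)\<in>r. \<bar>p v - p u\<bar> \<le> d" for p d i j
    using L(2)[OF that(2), of j i] mult_right_mono[OF le[of i j] that(1)] by linarith
  ultimately show ?thesis by blast
qed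

text \<open>
  A quantity of weighted mean zero is at each index the weighted average of its differences to
  the other indices, hence nowhere larger than the spread.
\<close>

lemma centered_energy_le_spread:
  fixes \<omega> p :: "'n::finite \<Rightarrow> real"
  assumes pos: "\<And>i. \<omega> i > 0" and centered: "(\<Sum>i\<in>UNIV. \<omega> i * p i) = 0"
    and spread: "\<And>i j. \<bar>p j - p i\<bar> \<le> D"
  shows "(\<Sum>i\<in>UNIV. \<omega> i * (p i)\<^sup>2) \<le> (\<Sum>i\<in>UNIV. \<omega> i) * D\<^sup>2"
proof -
  define W where "W = (\<Sum>i\<in>UNIV. \<omega> i)"
  have W: "W > 0" unfolding W_def using pos by (intro sum_pos) auto
  have "\<bar>p i\<bar> \<le> D" for i
  proof -
    have "W * p i = (\<Sum>j\<in>UNIV. \<omega> j * (p i - p j))"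
      by (simp add: W_def right_diff_distrib sum_subtractf centered sum_distrib_right)
    moreover have "W * \<bar>p i\<bar> = \<bar>W * p i\<bar>" using W by (simp add: abs_mult)
    ultimately have "W * \<bar>p i\<bar> = \<bar>\<Sum>j\<in>UNIV. \<omega> j * (p i - p j)\<bar>" by simp
    also have "\<dots> \<le> (\<Sum>j\<in>UNIV. \<omega> j * D)"
      using pos spread
      by (intro order_trans[OF sum_abs] sum_mono) (auto simp: abs_mult less_imp_le)
    finally have "W * \<bar>p i\<bar> \<le> W * D" by (simp add: W_def sum_distrib_right)
    with W show ?thesis by simp
  qed
  then have "(p i)\<^sup>2 \<le> D\<^sup>2" for i by (metis power2_abs power_mono abs_ge_zero)
  then have "(\<Sum>i\<in>UNIV. \<omega> i * (p i)\<^sup>2) \<le> (\<Sum>i\<in>UNIV. \<omega> i * D\<^sup>2)"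
    using pos by (intro sum_mono mult_left_mono) (auto simp: less_imp_le)
  then show ?thesis by (simp add: sum_distrib_right)
qed

text \<open>
  Rescaling the energy by a constant \<open>Q\<close> that exceeds both its bound \<open>E\<^sub>0\<close> and the constant of
  the spread estimate does two things at once: some arc carries a difference of at least
  \<open>s = sqrt (E / Q)\<close>, and \<open>s \<le> 1\<close>, so that replacing the exponent of that unknown arc by
  the largest one only decreases the power.
\<close>

lemma dissipation_ge_energy_powr:
  fixes w \<alpha> :: "'n::finite \<Rightarrow> 'n \<Rightarrow> real" and \<omega> :: "'n \<Rightarrow> real"
  assumes w: "\<And>i j. w i j \<ge> 0"
    and connected: "\<And>i j. (i, j) \<in> {(i, j). w i j > 0}\<^sup>*"
    and \<alpha>: "\<And>i j. w i j > 0 \<Longrightarrow> 0 < \<alpha> i j \<and> \<alpha> i j < 1"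
    and \<omega>: "\<And>i. \<omega> i > 0"
  shows "\<exists>c \<beta>. c > 0 \<and> \<beta> < 1 \<and>
    (\<forall>p. (\<Sum>i\<in>UNIV. \<omega> i * p i) = 0 \<longrightarrow> (\<Sum>i\<in>UNIV. \<omega> i * (p i)\<^sup>2) \<le> E\<^sub>0 \<longrightarrow>
      c * (\<Sum>i\<in>UNIV. \<omega> i * (p i)\<^sup>2) powr \<beta>
        \<le> (\<Sum>i\<in>UNIV. \<Sum>j\<in>UNIV. w i j * \<bar>p j - p i\<bar> powr (1 + \<alpha> i j)))"
proof -
  define arcs where "arcs = {(i, j). w i j > 0}"
  \<comment> \<open>The default elements \<open>1\<close> and \<open>0\<close> cover the graph without arcs, a single vertex.\<close>
  define m where "m = Min (insert 1 ((\<lambda>(i, j). w i j) ` arcs))"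
  have m: "m > 0" "\<And>i j. w i j > 0 \<Longrightarrow> m \<le> w i j"
    by (auto simp: m_def arcs_def image_iff intro!: Min_le)
  define a where "a = Max (insert 0 ((\<lambda>(i, j). \<alpha> i j) ` arcs))"
  have "a < 1" using \<alpha> by (auto simp: a_def arcs_def)
  have a: "\<alpha> i j \<le> a" if "w i j > 0" for i j
    using that by (auto simp: a_def arcs_def image_iff intro!: Max_ge)
  from difference_le_of_connected[OF connected] obtain L :: real where
    L: "\<And>p d i j. d \<ge> 0 \<Longrightarrow> (\<And>i j. w i j > 0 \<Longrightarrow> \<bar>p j - p i\<bar> \<le> d) \<Longrightarrow> \<bar>p j - p i\<bar> \<le> L * d"
    by fastforce
  define W where "W = (\<Sum>i\<in>UNIV. \<omega> i)"
  have W: "W > 0" unfolding W_def using \<omega> by (intro sum_pos) auto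
  define Q where "Q = W * L\<^sup>2 + \<bar>E\<^sub>0\<bar> + 1"
  have "W * L\<^sup>2 \<ge> 0" using W by simp
  then have Q: "Q > 0" "Q > W * L\<^sup>2" "Q > E\<^sub>0" unfolding Q_def by linarith+
  define \<beta> where "\<beta> = (1 + a) / 2"
  have two_\<beta>: "2 * \<beta> = 1 + a" by (simp add: \<beta>_def)
  have "m * (1 / Q) powr \<beta> * (\<Sum>i\<in>UNIV. \<omega> i * (p i)\<^sup>2) powr \<beta>
      \<le> (\<Sum>i\<in>UNIV. \<Sum>j\<in>UNIV. w i j * \<bar>p j - p i\<bar> powr (1 + \<alpha> i j))"
    if centered: "(\<Sum>i\<in>UNIV. \<omega> i * p i) = 0" and le: "(\<Sum>i\<in>UNIV. \<omega> i * (p i)\<^sup>2) \<le> E\<^sub>0" for p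
  proof -
    define E where "E = (\<Sum>i\<in>UNIV. \<omega> i * (p i)\<^sup>2)"
    define h where "h = (\<lambda>i j. w i j * \<bar>p j - p i\<bar> powr (1 + \<alpha> i j))"
    have h: "h i j \<ge> 0" for i j using w by (simp add: h_def)
    have E: "E \<ge> 0" unfolding E_def using \<omega> by (intro sum_nonneg) (auto simp: less_imp_le)
    have "m * (1 / Q) powr \<beta> * E powr \<beta> \<le> (\<Sum>i\<in>UNIV. \<Sum>j\<in>UNIV. h i j)"
    proof (cases "E = 0")
      case True
      then show ?thesis using h by (simp add: sum_nonneg)
    next
      case False
      define s where "s = sqrt (E / Q)"
      have s: "s > 0" "s\<^sup>2 = E / Q" "s \<le> 1"
        using E False Q le by (auto simp: s_def E_def)
      have "\<exists>i j. w i j > 0 \<and> \<bar>p j - p i\<bar> \<ge> s"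
      proof (rule ccontr)
        assume "\<not> ?thesis"
        then have "\<bar>p j - p i\<bar> \<le> L * s" for i j
          using s(1) by (intro L) (force simp: not_le)+
        from centered_energy_le_spread[of \<omega> p, OF \<omega> centered this]
        have "E \<le> W * (L * s)\<^sup>2" unfolding E_def W_def .
        also have "\<dots> = W * L\<^sup>2 * (E / Q)" by (simp add: power_mult_distrib s(2))
        also have "\<dots> < Q * (E / Q)" using Q E False by (intro mult_strict_right_mono) auto
        finally show False using Q by simp
      qed
      then obtain i j where ij: "w i j > 0" "\<bar>p j - p i\<bar> \<ge> s" by blast
      have "m * (1 / Q) powr \<beta> * E powr \<beta> = m * (s\<^sup>2) powr \<beta>"
        using Q E by (simp add: s(2) flip: powr_mult)
      also have "\<dots> = m * s powr (1 + a)"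
        using s(1) two_\<beta> by (simp add: powr_powr flip: powr_numeral)
      also have "\<dots> \<le> w i j * \<bar>p j - p i\<bar> powr (1 + \<alpha> i j)"
      proof (rule mult_mono)
        have "s powr (1 + a) \<le> s powr (1 + \<alpha> i j)"
          using s a[OF ij(1)] by (intro powr_mono') auto
        also have "\<dots> \<le> \<bar>p j - p i\<bar> powr (1 + \<alpha> i j)"
          using s ij \<alpha>[OF ij(1)] by (intro powr_mono2) auto
        finally show "s powr (1 + a) \<le> \<bar>p j - p i\<bar> powr (1 + \<alpha> i j)" .
      qed (use m(2)[OF ij(1)] w in auto)
      also have "\<dots> = h i j" by (simp add: h_def)
      also have "\<dots> \<le> (\<Sum>j\<in>UNIV. h i j)" by (rule member_le_sum) (auto simp: h)
      also have "\<dots> \<le> (\<Sum>i\<in>UNIV. \<Sum>j\<in>UNIV. h i j)"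
        by (rule member_le_sum[where f = "\<lambda>i. \<Sum>j\<in>UNIV. h i j"]) (auto simp: h intro: sum_nonneg)
      finally show ?thesis .
    qed
    then show ?thesis by (simp add: E_def h_def)
  qed
  moreover have "m * (1 / Q) powr \<beta> > 0" using m Q by simp
  moreover have "\<beta> < 1" using \<open>a < 1\<close> by (simp add: \<beta>_def)
  ultimately show ?thesis by blast
qed

section \<open>The consensus protocol\<close>

lemma matrix_digraph_walk:
  assumes "strongly_connected (matrix_digraph A)"
  shows "(i, j) \<in> {(i, j). A $ j $ i > 0}\<^sup>*"
proof -
  have "arcs_ends (matrix_digraph A) = {(i, j). A $ j $ i > 0}"
    by (auto simp: arcs_ends_def arc_to_ends_def matrix_digraph_def)
  moreover have "i \<rightarrow>\<^sup>*\<^bsub>matrix_digraph A\<^esub> j"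
    using assms by (auto simp: strongly_connected_def matrix_digraph_def)
  ultimately show ?thesis using reachable_rtranclI by metis
qed

lemma consensus_protocol_nth:
  fixes A :: "real ^ 'n ^ 'n"
  assumes "\<And>i j. A $ i $ j \<ge> 0" "\<And>i. A $ i $ i = 0"
  shows "consensus_protocol A \<alpha> x $ i = (\<Sum>j\<in>UNIV. A $ i $ j * sig (x $ j - x $ i) (\<alpha> i j))"
proof -
  have "A $ i $ j = 0" if "j \<notin> neighbours A i" for j
    using that assms(1)[of i j] assms(2)[of i] by (cases "i = j") (auto simp: neighbours_def)
  then have "(\<Sum>j\<in>neighbours A i. A $ i $ j * sig (x $ j - x $ i) (\<alpha> i j))
      = (\<Sum>j\<in>UNIV. A $ i $ j * sig (x $ j - x $ i) (\<alpha> i j))"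
    by (intro sum.mono_neutral_left) auto
  then show ?thesis by (simp add: consensus_protocol_def)
qed

theorem corollary4:
  fixes A :: "real ^ 'n ^ 'n" and \<alpha> :: "'n \<Rightarrow> 'n \<Rightarrow> real"
  assumes "\<And>i j. A $ i $ j \<ge> 0"
    and "\<And>i. A $ i $ i = 0"
    and "\<And>i j. j \<in> neighbours A i \<Longrightarrow> 0 < \<alpha> i j \<and> \<alpha> i j < 1"
    and "strongly_connected (matrix_digraph A)"
    and "detail_balanced A"
    and "\<And>i j. j \<in> neighbours A i \<Longrightarrow> \<alpha> i j = \<alpha> j i"
  shows "solves_finite_time_consensus (consensus_protocol A \<alpha>)"
proof -
  obtain \<omega> :: "'n \<Rightarrow> real" where \<omega>: "\<And>i. \<omega> i > 0"
    and balance: "\<And>i j. \<omega> i * A $ i $ j = \<omega> j * A $ j $ i"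
    using assms(5) by (auto simp: detail_balanced_def)
  define w where "w = (\<lambda>i j. \<omega> i * A $ i $ j)"
  have w_sym: "w i j = w j i" for i j using balance by (simp add: w_def)
  have w_nonneg: "w i j \<ge> 0" for i j using \<omega>[of i] assms(1)[of i j] by (simp add: w_def)
  have neighbour: "j \<in> neighbours A i" if "w i j \<noteq> 0" for i j
    using that assms(1)[of i j] assms(2)[of i]
    by (cases "i = j") (auto simp: w_def neighbours_def order_less_le)
  have \<alpha>_sym: "\<alpha> i j = \<alpha> j i" if "w i j \<noteq> 0" for i j
    using assms(6)[OF neighbour[OF that]] .
  have \<alpha>_bounds: "0 < \<alpha> i j \<and> \<alpha> i j < 1" if "w i j > 0" for i j
    using that assms(3)[OF neighbour[of i j]] by simp
  \<comment> \<open>An arc from \<open>i\<close> to \<open>j\<close> is recorded in \<open>A $ j $ i\<close>; the symmetry of \<open>w\<close> absorbs the swap.\<close>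
  have "w i j > 0 \<longleftrightarrow> A $ j $ i > 0" for i j
    unfolding w_sym[of i j] using \<omega>[of j] by (auto simp: w_def zero_less_mult_iff)
  then have connected: "(i, j) \<in> {(i, j). w i j > 0}\<^sup>*" for i j
    using matrix_digraph_walk[OF assms(4)] by simp

  have weighted_protocol:
    "\<omega> i * consensus_protocol A \<alpha> y $ i = (\<Sum>j\<in>UNIV. w i j * sig (y $ j - y $ i) (\<alpha> i j))" for y i
    by (simp add: consensus_protocol_nth[OF assms(1,2)] w_def sum_distrib_left mult.assoc)

  have consensus: "\<exists>T\<ge>0. \<exists>\<kappa>. \<forall>t\<ge>T. \<forall>j. x t $ j = \<kappa>"
    if "is_solution (consensus_protocol A \<alpha>) x" for x
  proof -
    define u where "u = (\<lambda>t. consensus_protocol A \<alpha> (x t))"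
    have deriv: "((\<lambda>t. x t $ i) has_real_derivative u t $ i) (at t within {0..})" if "t \<ge> 0" for t i
      using that \<open>is_solution _ x\<close>
        bounded_linear.has_vector_derivative[OF bounded_linear_vec_nth, of x "u t" _ i]
      by (auto simp: is_solution_def u_def has_real_derivative_iff_has_vector_derivative)
    have total_flow: "(\<Sum>i\<in>UNIV. \<omega> i * u t $ i) = 0" for t
      unfolding u_def weighted_protocol
      by (rule sum_antisymmetric_eq_0,
          rule symmetric_flow_antisymmetric[where p = "\<lambda>i. x t $ i", OF w_sym \<alpha>_sym])
    have mean: "(\<Sum>i\<in>UNIV. \<omega> i * x t $ i) = (\<Sum>i\<in>UNIV. \<omega> i * x 0 $ i)" if "t \<ge> 0" for t
    proof -
      have "((\<lambda>t. \<Sum>i\<in>UNIV. \<omega> i * x t $ i) has_real_derivative 0) (at s within {0..})"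
        if "s \<ge> 0" for s
      proof -
        have "((\<lambda>t. \<Sum>i\<in>UNIV. \<omega> i * x t $ i) has_real_derivative (\<Sum>i\<in>UNIV. \<omega> i * u s $ i))
            (at s within {0..})"
          by (intro DERIV_sum DERIV_cmult deriv that)
        then show ?thesis by (simp add: total_flow)
      qed
      then have "\<exists>k. \<forall>s\<in>{0..}. (\<Sum>i\<in>UNIV. \<omega> i * x s $ i) = k"
        by (intro has_field_derivative_zero_constant convex_real_interval) simp
      with that show ?thesis by auto
    qed
    define \<kappa> where "\<kappa> = (\<Sum>i\<in>UNIV. \<omega> i * x 0 $ i) / (\<Sum>i\<in>UNIV. \<omega> i)"
    define p where "p = (\<lambda>t i. x t $ i - \<kappa>)"
    define E where "E = (\<lambda>t. \<Sum>i\<in>UNIV. \<omega> i * (p t i)\<^sup>2)"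
    define E' where "E' = (\<lambda>t. - (\<Sum>i\<in>UNIV. \<Sum>j\<in>UNIV. w i j * \<bar>p t j - p t i\<bar> powr (1 + \<alpha> i j)))"
    have "(\<Sum>i\<in>UNIV. \<omega> i) > 0" using \<omega> by (intro sum_pos) auto
    then have "(\<Sum>i\<in>UNIV. \<omega> i) * \<kappa> = (\<Sum>i\<in>UNIV. \<omega> i * x 0 $ i)" by (simp add: \<kappa>_def)
    then have centered: "(\<Sum>i\<in>UNIV. \<omega> i * p t i) = 0" if "t \<ge> 0" for t
      using mean[OF that]
      by (simp add: p_def right_diff_distrib sum_subtractf flip: sum_distrib_right)
    have E_nonneg: "E t \<ge> 0" for t
      unfolding E_def using \<omega> by (intro sum_nonneg) (auto simp: less_imp_le)
    have E_deriv: "(E has_real_derivative E' t) (at t within {0..})" if "t \<ge> 0" for t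
    proof -
      have "(E has_real_derivative (\<Sum>i\<in>UNIV. \<omega> i * (2 * p t i * u t $ i))) (at t within {0..})"
        unfolding E_def p_def
        by (intro DERIV_sum DERIV_cmult)
           (auto intro!: derivative_eq_intros deriv[OF that])
      also have "(\<Sum>i\<in>UNIV. \<omega> i * (2 * p t i * u t $ i)) = 2 * (\<Sum>i\<in>UNIV. p t i * (\<omega> i * u t $ i))"
        by (simp add: sum_distrib_left mult_ac)
      also have "\<dots> = 2 * (\<Sum>i\<in>UNIV. p t i * (\<Sum>j\<in>UNIV. w i j * sig (p t j - p t i) (\<alpha> i j)))"
        by (simp add: u_def weighted_protocol p_def)
      also have "\<dots> = E' t"
        unfolding E'_def by (rule symmetric_flow_dissipation[OF w_sym \<alpha>_sym])
      finally show ?thesis .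
    qed
    have E_le: "E t \<le> E 0" if "t \<ge> 0" for t
    proof -
      have "E t \<le> E 0 + 0 * (t - 0)"
      proof (rule decrease_of_derivative_le[where f' = E', OF that])
        fix s assume "0 \<le> s" "s \<le> t"
        then show "(E has_real_derivative E' s) (at s within {0..t})"
          using E_deriv[of s] by (auto intro: DERIV_subset)
        show "E' s \<le> 0" unfolding E'_def using w_nonneg by (simp add: sum_nonneg)
      qed
      then show ?thesis by simp
    qed
    obtain c \<beta> where c: "c > 0" "\<beta> < 1"
      and dissipation: "\<forall>q. (\<Sum>i\<in>UNIV. \<omega> i * q i) = 0 \<longrightarrow> (\<Sum>i\<in>UNIV. \<omega> i * (q i)\<^sup>2) \<le> E 0 \<longrightarrow>
        c * (\<Sum>i\<in>UNIV. \<omega> i * (q i)\<^sup>2) powr \<beta>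
          \<le> (\<Sum>i\<in>UNIV. \<Sum>j\<in>UNIV. w i j * \<bar>q j - q i\<bar> powr (1 + \<alpha> i j))"
      by (atomize_elim, rule dissipation_ge_energy_powr)
         (simp_all add: w_nonneg connected \<alpha>_bounds \<omega>)
    have decay: "E' t \<le> - c * E t powr \<beta>" if "t \<ge> 0" for t
      using dissipation[rule_format, of "p t"] centered[OF that] E_le[OF that]
      by (simp add: E_def E'_def)
    obtain T where T: "T \<ge> 0" "\<And>t. t \<ge> T \<Longrightarrow> E t = 0"
      using finite_time_extinction[OF E_deriv E_nonneg decay c] by blast
    have "x t $ j = \<kappa>" if "t \<ge> T" for t j
    proof -
      have "\<forall>i\<in>UNIV. \<omega> i * (p t i)\<^sup>2 = 0"
        using T(2)[OF that] \<omega> unfolding E_def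
        by (subst (asm) sum_nonneg_eq_0_iff) (auto simp: less_imp_le)
      then have "\<omega> j * (p t j)\<^sup>2 = 0" by blast
      then show ?thesis using \<omega>[of j] by (simp add: p_def)
    qed
    with T(1) show ?thesis by blast
  qed

  show ?thesis
    unfolding solves_finite_time_consensus_def
  proof (intro allI impI, elim conjE)
    fix x\<^sub>0 x
    assume "is_solution (consensus_protocol A \<alpha>) x"
    from consensus[OF this] obtain T \<kappa> where
      T: "T \<ge> 0" and agree: "\<And>t j. t \<ge> T \<Longrightarrow> x t $ j = \<kappa>" by blast
    have "((\<lambda>t. \<bar>x t $ j - x t $ k\<bar>) \<longlongrightarrow> 0) at_top" for j k
      by (intro tendsto_eventually eventually_at_top_linorderI[of T]) (simp add: agree)
    moreover have "\<exists>T\<ge>0. \<exists>\<kappa>. \<forall>t\<ge>T. \<forall>j. x t $ j = \<kappa>"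
      using T agree by blast
    ultimately show "(\<forall>j k. ((\<lambda>t. \<bar>x t $ j - x t $ k\<bar>) \<longlongrightarrow> 0) at_top) \<and>
        (\<exists>T\<ge>0. \<exists>\<kappa>. \<forall>t\<ge>T. \<forall>j. x t $ j = \<kappa>)" by blast
  qed
qed

end
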